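(* Let $f=(f_1,\ldots,f_n)$ be an $n$-tuple of formal power series in noncommuting indeterminates $Z_1,\ldots,Z_n$ with nonzero radius of convergence such that $f(0)=0$ and $\det J_f(0)\neq 0$. Let $g=(g_1,\ldots,g_n)$ be the inverse power series of $f$ with respect to composition. If $g$ has a nonzero radius of convergence, then there are open neighborhoods $D$ and $G$ of $0$ in $B(\mathcal H)^n$ such that $f|_D:D\to G$ is a bijective free holomorphic function whose inverse is a free holomorphic function on $G$ which coincides with $g|_G:G\to D$.
   Context: $\mathcal H$ is a separable infinite-dimensional complex Hilbert space and $B(\mathcal H)$ the algebra of bounded operators on it; $B(\mathcal H)^n$ carries the operator norm topology. $\mathbb F_n^+$ is the free semigroup on $g_1,\ldots,g_n$ with identity $g_0$; for $\alpha=g_{i_1}\cdots g_{i_k}$, $X_\alpha=X_{i_1}\cdots X_{i_k}$, $X_{g_0}=I$, $|\alpha|=k$. For a formal power series $F=\sum_\alpha a_\alpha Z_\alpha$ ($a_\alpha\in\mathbb C$), its radius of convergence $r(F)$ is given by $r(F)^{-1}=\limsup_{k\to\infty}\big(\sum_{|\alpha|=k}|a_\alpha|^2\big)^{1/2k}$; for a tuple, $r(f)=\min_i r(f_i)$. $f(0)$ is the tuple of constant coefficients and $J_f(0)$ is the $n\times n$ matrix whose $(i,j)$ entry is the coefficient of $Z_j$ in $f_i$. When $f(0)=0$ and $\det J_f(0)\ne0$ there is a unique $n$-tuple $g$ of formal power series with $g(0)=0$ and $f\circ g=g\circ f=\mathrm{id}$ as formal power series; it is called the inverse of $f$ with respect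 to composition. If $\Omega\subset B(\mathcal H)^n$ contains a ball $\{X:\|X_1X_1^*+\cdots+X_nX_n^*\|^{1/2}<r\}$ for some $r>0$, a map $\Omega\to B(\mathcal H)$ is free holomorphic if it is of the form $X\mapsto\sum_{k=0}^\infty\sum_{|\alpha|=k}a_\alpha X_\alpha$ with the series (in $k$) convergent in the operator norm for all $X\in\Omega$; a map into $B(\mathcal H)^n$ is free holomorphic if its components are. $f|_D$ and $g|_G$ denote the maps obtained by evaluating the power series $f$, $g$ in this way. *)

theory Defs
  imports "HOL-Analysis.Analysis"
begin

section \<open>Complex Hilbert spaces\<close>

class scaleC =
  fixes scaleC :: "complex \<Rightarrow> 'a \<Rightarrow> 'a"  (infixr "*\<^sub>C" 75)

text \<open>The inner product is linear in the first argument. Completeness and the real normed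
  structure come from \<^class>\<open>banach\<close>; the last axiom says that the norm is the one induced by the
  inner product.\<close>

class chilbert_space = banach + scaleC +
  fixes cinner :: "'a \<Rightarrow> 'a \<Rightarrow> complex"
  assumes scaleC_add_right: "c *\<^sub>C (x + y) = c *\<^sub>C x + c *\<^sub>C y"
    and scaleC_add_left: "(c + d) *\<^sub>C x = c *\<^sub>C x + d *\<^sub>C x"
    and scaleC_scaleC: "c *\<^sub>C d *\<^sub>C x = (c * d) *\<^sub>C x"
    and scaleC_of_real: "complex_of_real r *\<^sub>C x = r *\<^sub>R x"
    and cinner_commute: "cinner x y = cnj (cinner y x)"
    and cinner_add_left: "cinner (x + y) z = cinner x z + cinner y z"
    and cinner_scaleC_left: "cinner (c *\<^sub>C x) y = c * cinner x y"
    and cinner_self: "cinner x x = complex_of_real ((norm x)\<^sup>2)"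

lemma cinner_scaleC_right: "cinner x (c *\<^sub>C y) = cnj c * cinner x (y::'a::chilbert_space)"
  by (metis cinner_commute cinner_scaleC_left complex_cnj_mult)

lemma norm_scaleC: "norm (c *\<^sub>C x) = cmod c * norm (x::'a::chilbert_space)"
proof -
  have "complex_of_real ((norm (c *\<^sub>C x))\<^sup>2) = (c * cnj c) * complex_of_real ((norm x)\<^sup>2)"
    by (metis cinner_self cinner_scaleC_left cinner_scaleC_right mult.assoc)
  also have "\<dots> = complex_of_real ((cmod c * norm x)\<^sup>2)"
    by (simp only: complex_norm_square[symmetric] power_mult_distrib of_real_mult)
  finally have "(norm (c *\<^sub>C x))\<^sup>2 = (cmod c * norm x)\<^sup>2"
    by (simp only: of_real_eq_iff)
  then show ?thesis
    by (simp add: power2_eq_iff_nonneg)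
qed

lemma scaleC_scaleR_commute: "c *\<^sub>C r *\<^sub>R x = r *\<^sub>R c *\<^sub>C (x::'a::chilbert_space)"
  by (metis scaleC_of_real scaleC_scaleC mult.commute)

lemma bounded_linear_scaleC: "bounded_linear (\<lambda>x::'a::chilbert_space. c *\<^sub>C x)"
  by (rule bounded_linear_intro[where K = "cmod c"])
    (simp_all add: scaleC_add_right scaleC_scaleR_commute norm_scaleC mult.commute)

definition infinite_dimensional :: "'a::chilbert_space itself \<Rightarrow> bool"
  where "infinite_dimensional _ \<longleftrightarrow> \<not> (\<exists>B::'a set. finite B \<and> module.span scaleC B = UNIV)"

section \<open>The algebra of bounded complex-linear operators\<close>

typedef (overloaded) 'a bop =
  "{A :: 'a::chilbert_space \<Rightarrow>\<^sub>L 'a. \<forall>c x. blinfun_apply A (c *\<^sub>C x) = c *\<^sub>C blinfun_apply A x}"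
  morphisms blinfun_of_bop Bop
  by (rule exI[of _ id_blinfun]) simp

setup_lifting type_definition_bop

lift_definition bop_apply :: "'a::chilbert_space bop \<Rightarrow> 'a \<Rightarrow> 'a" is blinfun_apply .

text \<open>The norm is the operator norm, inherited from the real-linear operators.\<close>

instantiation bop :: (chilbert_space) "{real_normed_algebra, monoid_mult, scaleC}"
begin

lift_definition norm_bop :: "'a bop \<Rightarrow> real" is norm .

lift_definition zero_bop :: "'a bop" is 0
  by (simp add: norm_scaleC flip: norm_eq_zero)

lift_definition plus_bop :: "'a bop \<Rightarrow> 'a bop \<Rightarrow> 'a bop" is "(+)"
  by (simp add: blinfun.add_left scaleC_add_right)

lift_definition scaleR_bop :: "real \<Rightarrow> 'a bop \<Rightarrow> 'a bop" is "(*\<^sub>R)"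
  by (simp add: blinfun.scaleR_left scaleC_scaleR_commute)

lift_definition uminus_bop :: "'a bop \<Rightarrow> 'a bop" is uminus
  by (metis mem_Collect_eq blinfun.minus_left scaleC_scaleR_commute scaleR_minus1_left)

lift_definition minus_bop :: "'a bop \<Rightarrow> 'a bop \<Rightarrow> 'a bop" is "(-)"
  by (simp add: blinfun.diff_left) (metis add_diff_cancel diff_add_cancel scaleC_add_right)

lift_definition times_bop :: "'a bop \<Rightarrow> 'a bop \<Rightarrow> 'a bop" is "(o\<^sub>L)"
  by simp

lift_definition one_bop :: "'a bop" is id_blinfun
  by simp

lift_definition scaleC_bop :: "complex \<Rightarrow> 'a bop \<Rightarrow> 'a bop"
  is "\<lambda>c A. Blinfun (\<lambda>x. c *\<^sub>C x) o\<^sub>L A"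
  by (simp add: bounded_linear_Blinfun_apply bounded_linear_scaleC scaleC_scaleC mult.commute)

definition dist_bop :: "'a bop \<Rightarrow> 'a bop \<Rightarrow> real"
  where "dist_bop A B = norm (A - B)"

definition sgn_bop :: "'a bop \<Rightarrow> 'a bop"
  where "sgn_bop A = inverse (norm A) *\<^sub>R A"

definition uniformity_bop :: "('a bop \<times> 'a bop) filter"
  where [code del]: "uniformity_bop = (INF e\<in>{0 <..}. principal {(A, B). dist A B < e})"

definition open_bop :: "'a bop set \<Rightarrow> bool"
  where [code del]: "open_bop S = (\<forall>A\<in>S. \<forall>\<^sub>F (A', B) in uniformity. A' = A \<longrightarrow> B \<in> S)"

instance
proof
  fix A B C :: "'a bop" and r s :: real
  show "dist A B = norm (A - B)" by (simp add: dist_bop_def)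
  show "sgn A = inverse (norm A) *\<^sub>R A" by (simp add: sgn_bop_def)
  show "uniformity = (INF e\<in>{0 <..}. principal {(A :: 'a bop, B). dist A B < e})"
    by (simp add: uniformity_bop_def)
  show "open U = (\<forall>A\<in>U. \<forall>\<^sub>F (A', B) in uniformity. A' = A \<longrightarrow> B \<in> U)" for U :: "'a bop set"
    by (simp add: open_bop_def)
  show "A + B + C = A + (B + C)" by transfer (simp add: algebra_simps)
  show "A + B = B + A" by transfer (simp add: algebra_simps)
  show "0 + A = A" by transfer simp
  show "- A + A = 0" by transfer simp
  show "A - B = A + - B" by transfer simp
  show "r *\<^sub>R (A + B) = r *\<^sub>R A + r *\<^sub>R B" by transfer (simp add: scaleR_right_distrib)
  show "(r + s) *\<^sub>R A = r *\<^sub>R A + s *\<^sub>R A" by transfer (simp add: scaleR_left_distrib)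
  show "r *\<^sub>R s *\<^sub>R A = (r * s) *\<^sub>R A" by transfer simp
  show "1 *\<^sub>R A = A" by transfer simp
  show "norm A = 0 \<longleftrightarrow> A = 0" by transfer simp
  show "norm (A + B) \<le> norm A + norm B" by transfer (rule norm_triangle_ineq)
  show "norm (r *\<^sub>R A) = \<bar>r\<bar> * norm A" by transfer simp
  show "A * B * C = A * (B * C)" by transfer (simp add: blinfun_eqI)
  show "(A + B) * C = A * C + B * C"
    by transfer (simp add: blinfun_eqI blinfun.add_left)
  show "A * (B + C) = A * B + A * C"
    by transfer (simp add: blinfun_eqI blinfun.add_left blinfun.add_right)
  show "r *\<^sub>R A * B = r *\<^sub>R (A * B)"
    by transfer (simp add: blinfun_eqI blinfun.scaleR_left)
  show "A * r *\<^sub>R B = r *\<^sub>R (A * B)"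
    by transfer (simp add: blinfun_eqI blinfun.scaleR_left blinfun.scaleR_right)
  show "norm (A * B) \<le> norm A * norm B" by transfer (rule norm_blinfun_compose)
  show "1 * A = A" by transfer (simp add: blinfun_eqI)
  show "A * 1 = A" by transfer (simp add: blinfun_eqI)
qed

end

lemma bop_apply_scaleC: "bop_apply (c *\<^sub>C A) x = c *\<^sub>C bop_apply A x"
  by transfer (simp add: bounded_linear_Blinfun_apply bounded_linear_scaleC)

text \<open>Existence of the adjoint is the Riesz representation theorem.\<close>

definition adj :: "'a::chilbert_space bop \<Rightarrow> 'a bop"
  where "adj A = (THE B. \<forall>x y. cinner (bop_apply A x) y = cinner x (bop_apply B y))"

section \<open>Formal power series in noncommuting indeterminates\<close>

text \<open>The indeterminates are indexed by a finite type \<^typ>\<open>'n\<close>, so \<open>n = CARD('n)\<close>. The free semigroup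
  is \<^typ>\<open>'n list\<close> with \<open>g\<^sub>0 = []\<close> and \<open>|\<alpha>| = length \<alpha>\<close>; a series is its coefficient function.\<close>

type_synonym 'n ncps = "'n list \<Rightarrow> complex"

definition ncps_one :: "'n ncps"
  where "ncps_one w = (if w = [] then 1 else 0)"

definition ncps_var :: "'n \<Rightarrow> 'n ncps"
  where "ncps_var i w = (if w = [i] then 1 else 0)"

definition ncps_mult :: "'n ncps \<Rightarrow> 'n ncps \<Rightarrow> 'n ncps"
  where "ncps_mult a b w = (\<Sum>k\<le>length w. a (take k w) * b (drop k w))"

definition ncps_word :: "('n \<Rightarrow> 'm ncps) \<Rightarrow> 'n list \<Rightarrow> 'm ncps"
  where "ncps_word g \<alpha> = foldr (\<lambda>i. ncps_mult (g i)) \<alpha> ncps_one"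

text \<open>\<open>F \<circ> g = \<Sum>\<^sub>\<alpha> F\<^sub>\<alpha> g\<^sub>\<alpha>\<close>. This is meant only for \<open>g\<close> without constant terms: the coefficient of
  \<open>w\<close> in \<open>g\<^sub>\<alpha>\<close> then vanishes whenever \<open>|\<alpha>| > |w|\<close>, so the sum may be cut off at \<open>|w|\<close>.\<close>

definition ncps_compose :: "'n::finite ncps \<Rightarrow> ('n \<Rightarrow> 'm ncps) \<Rightarrow> 'm ncps"
  where "ncps_compose F g w = (\<Sum>\<alpha> | length \<alpha> \<le> length w. F \<alpha> * ncps_word g \<alpha> w)"

definition zero_const :: "('n \<Rightarrow> 'n ncps) \<Rightarrow> bool"
  where "zero_const f \<longleftrightarrow> (\<forall>i. f i [] = 0)"

definition jacobian0 :: "('n::finite \<Rightarrow> 'n ncps) \<Rightarrow> complex^'n^'n"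
  where "jacobian0 f = (\<chi> i j. f i [j])"

definition comp_inverse :: "('n::finite \<Rightarrow> 'n ncps) \<Rightarrow> ('n \<Rightarrow> 'n ncps) \<Rightarrow> bool"
  where "comp_inverse f g \<longleftrightarrow> zero_const g \<and>
    (\<forall>i. ncps_compose (f i) g = ncps_var i) \<and> (\<forall>i. ncps_compose (g i) f = ncps_var i)"

text \<open>In \<^typ>\<open>ereal\<close>, \<open>inverse 0 = \<infinity>\<close> and \<open>inverse \<infinity> = 0\<close>.\<close>

definition ncps_radius :: "'n::finite ncps \<Rightarrow> ereal"
  where "ncps_radius F =
    inverse (limsup (\<lambda>k. ereal (root (2 * k) (\<Sum>\<alpha> | length \<alpha> = k. (cmod (F \<alpha>))\<^sup>2))))"

definition tuple_radius :: "('n::finite \<Rightarrow> 'n ncps) \<Rightarrow> ereal"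
  where "tuple_radius f = (MIN i. ncps_radius (f i))"

section \<open>Evaluation and free holomorphic maps\<close>

definition op_word :: "'a::chilbert_space bop^'n \<Rightarrow> 'n list \<Rightarrow> 'a bop"
  where "op_word X \<alpha> = prod_list (map (\<lambda>i. X $ i) \<alpha>)"

definition hom_part :: "'n::finite ncps \<Rightarrow> 'a::chilbert_space bop^'n \<Rightarrow> nat \<Rightarrow> 'a bop"
  where "hom_part F X k = (\<Sum>\<alpha> | length \<alpha> = k. F \<alpha> *\<^sub>C op_word X \<alpha>)"

definition converges_on :: "('n::finite \<Rightarrow> 'n ncps) \<Rightarrow> ('a::chilbert_space bop^'n) set \<Rightarrow> bool"
  where "converges_on f \<Omega> \<longleftrightarrow> (\<forall>X\<in>\<Omega>. \<forall>i. summable (hom_part (f i) X))"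

text \<open>Only meaningful where the series converge, see \<^const>\<open>converges_on\<close>.\<close>

definition eval_tuple :: "('n::finite \<Rightarrow> 'n ncps) \<Rightarrow> 'a::chilbert_space bop^'n \<Rightarrow> 'a bop^'n"
  where "eval_tuple f X = (\<chi> i. \<Sum>k. hom_part (f i) X k)"

definition op_ball :: "real \<Rightarrow> ('a::chilbert_space bop^'n::finite) set"
  where "op_ball r = {X. sqrt (norm (\<Sum>i\<in>UNIV. X $ i * adj (X $ i))) < r}"

definition free_holomorphic ::
    "('a::chilbert_space bop^'n::finite) set \<Rightarrow> ('a bop^'n \<Rightarrow> 'a bop) \<Rightarrow> bool"
  where "free_holomorphic \<Omega> \<phi> \<longleftrightarrow> (\<exists>r>0. op_ball r \<subseteq> \<Omega>) \<and>
    (\<exists>F. \<forall>X\<in>\<Omega>. hom_part F X sums \<phi> X)"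

definition free_holomorphic_map ::
    "('a::chilbert_space bop^'n::finite) set \<Rightarrow> ('a bop^'n \<Rightarrow> 'a bop^'n) \<Rightarrow> bool"
  where "free_holomorphic_map \<Omega> \<Phi> \<longleftrightarrow> (\<forall>i. free_holomorphic \<Omega> (\<lambda>X. \<Phi> X $ i))"

end

theory Submission
  imports Defs
begin

text \<open>A nonzero radius of convergence gives \<open>|F\<^sub>\<alpha>| \<le> C M\<^bsup>|\<alpha>|\<^esup>\<close>, so each series converges absolutely, as a
  sum over all words, on some polyball \<open>\<parallel>X\<^sub>i\<parallel> \<le> \<rho>\<close>. Absolute convergence turns composition of formal
  series into composition of the evaluated maps once the inner norms \<open>\<Sum>\<^sub>\<alpha> |f\<^sub>\<alpha>| \<eta>\<^bsup>|\<alpha>|\<^esup>\<close> are at most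
  \<open>\<rho>\<close>, which holds for small \<open>\<eta>\<close> as constant terms vanish. Hence \<open>f\<close> and \<open>g\<close> are mutually inverse between
  the symmetric domains \<open>D = {\<parallel>X\<^sub>i\<parallel> < \<eta>, \<parallel>f\<^sub>i(X)\<parallel> < \<eta>}\<close> and \<open>G = {\<parallel>Y\<^sub>i\<parallel> < \<eta>, \<parallel>g\<^sub>i(Y)\<parallel> < \<eta>}\<close>. The
  row ball lies in the polyball of the same radius because \<open>X\<^sub>iX\<^sub>i\<^sup>* \<le> \<Sum>\<^sub>j X\<^sub>jX\<^sub>j\<^sup>*\<close>.\<close>

section \<open>Adjoints and the row norm\<close>

lemma cinner_add_right: "cinner x (y + z) = cinner x y + cinner (x :: 'a::chilbert_space) z"
  by (metis cinner_add_left cinner_commute complex_cnj_add)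

lemma cinner_scaleR_left: "cinner (r *\<^sub>R x) y = of_real r * cinner (x :: 'a::chilbert_space) y"
  by (metis cinner_scaleC_left scaleC_of_real)

lemma cinner_scaleR_right: "cinner x (r *\<^sub>R y) = of_real r * cinner (x :: 'a::chilbert_space) y"
  by (metis cinner_scaleC_right scaleC_of_real complex_cnj_complex_of_real)

lemma cinner_minus_left: "cinner (- x) y = - cinner (x :: 'a::chilbert_space) y"
  using cinner_scaleR_left[of "-1" x y] by simp

lemma cinner_minus_right: "cinner x (- y) = - cinner (x :: 'a::chilbert_space) y"
  using cinner_scaleR_right[of x "-1" y] by simp

lemma cinner_diff_right: "cinner x (y - z) = cinner x y - cinner (x :: 'a::chilbert_space) z"
  using cinner_add_right[of x y "- z"] by (simp add: cinner_minus_right)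

lemma cinner_zero_left [simp]: "cinner 0 (y :: 'a::chilbert_space) = 0"
  using cinner_scaleR_left[of 0 0 y] by simp

lemma cinner_sum_left: "cinner (sum F A) (y :: 'a::chilbert_space) = (\<Sum>i\<in>A. cinner (F i) y)"
  by (induction A rule: infinite_finite_induct) (simp_all add: cinner_add_left)

lemma Re_cinner_self: "Re (cinner x x) = (norm (x :: 'a::chilbert_space))\<^sup>2"
  by (simp add: cinner_self)

lemma Re_cinner_commute: "Re (cinner x y) = Re (cinner y (x :: 'a::chilbert_space))"
  by (metis cinner_commute complex_cnj(1) complex.sel(1) complex_cnj complex.collapse)

lemma norm_add_scaleR_square:
  "(norm (x + t *\<^sub>R y))\<^sup>2 = (norm x)\<^sup>2 + 2 * t * Re (cinner y x) + t\<^sup>2 * (norm (y :: 'a::chilbert_space))\<^sup>2"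
proof -
  have "(norm (x + t *\<^sub>R y))\<^sup>2 = Re (cinner (x + t *\<^sub>R y) (x + t *\<^sub>R y))"
    by (simp add: Re_cinner_self)
  also have "\<dots> = (norm x)\<^sup>2 + t * Re (cinner x y) + t * Re (cinner y x) + t\<^sup>2 * (norm y)\<^sup>2"
    by (simp add: cinner_add_left cinner_add_right cinner_scaleR_left cinner_scaleR_right
        Re_cinner_self power2_eq_square algebra_simps)
  finally show ?thesis
    by (simp add: Re_cinner_commute[of x y])
qed

text \<open>Near 0 the linear term dominates, so a nonzero \<open>a\<close> would give a negative
  value on one side. In \<open>riesz_real\<close> this is the first-order condition at the
  minimiser.\<close>

lemma quadratic_nonneg_imp_linear_zero:
  fixes a b :: real
  assumes "\<And>t. 0 \<le> t * a + t\<^sup>2 * b"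
  shows "a = 0"
proof (rule ccontr)
  assume "a \<noteq> 0"
  \<comment> \<open>Any positive \<open>c\<close> exceeding \<open>b\<close> works: at
    \<open>t = - a / c\<close> the expression equals \<open>a\<^sup>2 / c\<^sup>2 * (b - c)\<close>,
    whatever the sign of \<open>b\<close>.\<close>
  define c where "c = \<bar>b\<bar> + 1"
  have "c > 0" "b < c" by (simp_all add: c_def)
  have "0 \<le> (- a / c) * a + (- a / c)\<^sup>2 * b" by (rule assms)
  also have "\<dots> = a\<^sup>2 / c\<^sup>2 * (b - c)"
    using \<open>c > 0\<close> by (simp add: field_simps power2_eq_square)
  also have "\<dots> < 0"
    using \<open>a \<noteq> 0\<close> \<open>c > 0\<close> \<open>b < c\<close> by (intro mult_pos_neg) simp_all
  finally show False by simp
qed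

text \<open>Scaling each vector by the norm of the other gives two vectors of equal length;
  expanding the square of their difference leaves a positive multiple of the defect in
  Cauchy-Schwarz.\<close>

lemma Re_cinner_le: "Re (cinner x y) \<le> norm x * norm (y :: 'a::chilbert_space)"
proof (cases "y = 0 \<or> x = 0")
  case True
  then show ?thesis
    by (metis Re_cinner_commute cinner_zero_left mult_eq_0_iff norm_eq_zero order_refl zero_complex.simps(1))
next
  case False
  have "0 \<le> (norm (norm y *\<^sub>R x + (- norm x) *\<^sub>R y))\<^sup>2" by simp
  also have "\<dots> = 2 * (norm x * norm y) * (norm x * norm y - Re (cinner x y))"
    unfolding norm_add_scaleR_square
    by (simp add: cinner_scaleR_right Re_cinner_commute[of x y] power2_eq_square algebra_simps)
  finally have "0 \<le> norm x * norm y - Re (cinner x y)"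
    using False by (subst (asm) zero_le_mult_iff) (auto simp: mult_le_0_iff)
  then show ?thesis by simp
qed

lemma norm_le_of_cinner_bound:
  fixes z :: "'a::chilbert_space"
  assumes "\<And>x. Re (cinner x z) \<le> K * norm x" "0 \<le> K"
  shows "norm z \<le> K"
proof (cases "z = 0")
  case False
  have "norm z * norm z \<le> K * norm z"
    using assms(1)[of z] by (simp add: Re_cinner_self power2_eq_square)
  then show ?thesis using False by simp
qed (use assms in simp)

text \<open>The representing vector is the minimiser of \<open>\<parallel>x\<parallel>\<^sup>2 - 2 Re \<phi>(x)\<close>; a minimising sequence is
  Cauchy by the parallelogram identity.\<close>

lemma riesz_real:
  fixes \<phi> :: "'a::chilbert_space \<Rightarrow> real"
  assumes "bounded_linear \<phi>"
  obtains z where "\<And>x. \<phi> x = Re (cinner x z)"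
proof -
  interpret bounded_linear \<phi> by fact
  obtain K where K: "\<And>x. \<bar>\<phi> x\<bar> \<le> norm x * K"
    using bounded by auto
  define J where "J x = (norm x)\<^sup>2 - 2 * \<phi> x" for x
  \<comment> \<open>Completing the square: \<open>J x\<close> is at least
    \<open>(norm x)\<^sup>2 - 2 * K * norm x\<close>, which is
    \<open>(norm x - K)\<^sup>2 - K\<^sup>2\<close>.\<close>
  have J_ge: "J x \<ge> - K\<^sup>2" for x
  proof -
    have "0 \<le> (norm x - K)\<^sup>2" by simp
    also have "\<dots> \<le> J x + K\<^sup>2"
      using K[of x] unfolding J_def by (auto simp: power2_eq_square algebra_simps)
    finally show ?thesis by simp
  qed
  define m where "m = Inf (range J)"
  have bdd: "bdd_below (range J)"
    using J_ge by (auto intro!: bdd_belowI)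
  have m_le: "m \<le> J x" for x
    unfolding m_def by (rule cInf_lower[OF _ bdd]) simp
  \<comment> \<open>The midpoint of x and y also has \<open>J\<close> at least \<open>m\<close>.
    This bounds \<open>norm (x + y)\<close> from below, and the parallelogram identity then bounds
    \<open>norm (x - y)\<close> from above.\<close>
  have par: "(norm (x - y))\<^sup>2 \<le> 2 * (J x - m) + 2 * (J y - m)" for x y
  proof -
    have eq: "(norm (x - y))\<^sup>2 = 2 * (norm x)\<^sup>2 + 2 * (norm y)\<^sup>2 - (norm (x + y))\<^sup>2"
      using norm_add_scaleR_square[of x 1 y] norm_add_scaleR_square[of x "-1" y] by simp
    have "J ((1/2) *\<^sub>R (x + y)) = (norm (x + y))\<^sup>2 / 4 - \<phi> x - \<phi> y"
      by (simp add: J_def scaleR add power_divide add_divide_distrib)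
    then show ?thesis
      using m_le[of "(1/2) *\<^sub>R (x + y)"] eq by (simp add: J_def)
  qed
  have "\<exists>x. J x < m + 1 / real (Suc k)" for k
    using cInf_lessD[of "range J" "m + 1 / real (Suc k)"] by (auto simp: m_def)
  then obtain s where s: "\<And>k. J (s k) < m + 1 / real (Suc k)"
    by metis
  have "Cauchy s"
  proof (rule CauchyI)
    fix e :: real assume "0 < e"
    \<comment> \<open>By \<open>par\<close>, two terms beyond \<open>N\<close> have squared distance
      below \<open>4 / real (Suc N)\<close>, hence the quarter.\<close>
    obtain N where N: "1 / real (Suc N) < e\<^sup>2 / 4"
      using reals_Archimedean[of "e\<^sup>2 / 4"] \<open>0 < e\<close> by (auto simp: inverse_eq_divide)
    have "norm (s k - s l) < e" if "k \<ge> N" "l \<ge> N" for k l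
    proof -
      have le: "1 / real (Suc j) \<le> 1 / real (Suc N)" if "j \<ge> N" for j
        using that by (simp add: frac_le)
      have "(norm (s k - s l))\<^sup>2 < e\<^sup>2"
        using par[of "s k" "s l"] s[of k] s[of l] le[OF \<open>k \<ge> N\<close>] le[OF \<open>l \<ge> N\<close>] N by argo
      then show ?thesis
        using \<open>0 < e\<close> by (simp add: power2_less_imp_less)
    qed
    then show "\<exists>M. \<forall>k\<ge>M. \<forall>l\<ge>M. norm (s k - s l) < e" by blast
  qed
  then obtain z where z: "s \<longlonglongrightarrow> z"
    using Cauchy_convergent convergent_def by blast
  have "(\<lambda>k. J (s k)) \<longlonglongrightarrow> J z"
    unfolding J_def by (intro tendsto_intros tendsto z)
  moreover have "(\<lambda>k. m + 1 / real (Suc k)) \<longlonglongrightarrow> m"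
    using tendsto_add[OF tendsto_const LIMSEQ_Suc[OF lim_1_over_n], of m] by simp
  ultimately have Jz: "J z \<le> m"
    by (rule LIMSEQ_le) (use s in \<open>auto intro: less_imp_le\<close>)
  have "\<phi> x = Re (cinner x z)" for x
  proof -
    \<comment> \<open>Minimality of z along the line through z in direction x: the right-hand side
      is \<open>J (z + t *\<^sub>R x) - J z\<close>.\<close>
    have "0 \<le> t * (2 * (Re (cinner x z) - \<phi> x)) + t\<^sup>2 * (norm x)\<^sup>2" for t
    proof -
      have "J (z + t *\<^sub>R x) - J z \<ge> 0"
        using Jz m_le[of "z + t *\<^sub>R x"] by simp
      then show ?thesis
        by (simp add: J_def norm_add_scaleR_square add scaleR algebra_simps)
    qed
    from quadratic_nonneg_imp_linear_zero[OF this] show ?thesis by simp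
  qed
  with that show ?thesis by blast
qed

text \<open>A complex-homogeneous functional is determined by its real part, because Im \<phi>(x) =
  - Re \<phi>(ix). This turns the real representation of \<open>riesz_real\<close> into a complex
  one.\<close>

lemma cinner_eqI_Re:
  fixes \<phi> :: "'a::chilbert_space \<Rightarrow> complex"
  assumes Re: "\<And>x. Re (\<phi> x) = Re (cinner x z)"
    and hom: "\<And>c x. \<phi> (c *\<^sub>C x) = c * \<phi> x"
  shows "\<phi> x = cinner x z"
proof (rule complex_eqI)
  show "Im (\<phi> x) = Im (cinner x z)"
    using Re[of "\<i> *\<^sub>C x"] by (simp add: hom cinner_scaleC_left)
qed (rule Re)

lemma cinner_right_cancel:
  assumes "\<And>x. cinner x y = cinner x (z :: 'a::chilbert_space)"
  shows "y = z"
proof -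
  have "cinner (y - z) (y - z) = 0"
    using assms[of "y - z"] by (simp add: cinner_diff_right)
  then show ?thesis by (simp add: cinner_self)
qed

section \<open>Operators acting on vectors, and their adjoints\<close>

lemma bop_apply_add_left: "bop_apply (A + B) x = bop_apply A x + bop_apply B x"
  by transfer (rule blinfun.add_left)

lemma bop_apply_zero_left [simp]: "bop_apply 0 x = 0"
  by transfer simp

lemma bop_apply_sum_left: "bop_apply (sum F I) x = (\<Sum>i\<in>I. bop_apply (F i) x)"
  by (induction I rule: infinite_finite_induct) (simp_all add: bop_apply_add_left)

lemma bop_apply_times: "bop_apply (A * B) x = bop_apply A (bop_apply B x)"
  by transfer simp

lemma bop_apply_scaleC_right: "bop_apply A (c *\<^sub>C x) = c *\<^sub>C bop_apply A x"
  by transfer simp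

lemma bounded_linear_bop_apply: "bounded_linear (bop_apply A)"
  by transfer (rule blinfun.bounded_linear_right)

lemma norm_bop_apply: "norm (bop_apply A x) \<le> norm A * norm x"
  by transfer (rule norm_blinfun)

lemma norm_bop_bound:
  assumes "0 \<le> K" "\<And>x. norm (bop_apply A x) \<le> K * norm x"
  shows "norm A \<le> K"
  using assms by transfer (rule norm_blinfun_bound)

lemma bop_eqI: "(\<And>x. bop_apply A x = bop_apply B x) \<Longrightarrow> A = B"
  by transfer (rule blinfun_eqI)

text \<open>For each y, Riesz represents x \<mapsto> <Ax, y> by a vector \<open>T y\<close>.
  Uniqueness of that vector makes T complex-linear, and Cauchy-Schwarz bounds it by
  \<open>norm A\<close>, so T is an element of the operator type.\<close>

lemma adjoint_exists:
  fixes A :: "'a::chilbert_space bop"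
  obtains B where "\<And>x y. cinner (bop_apply A x) y = cinner x (bop_apply B y)"
proof -
  interpret A: bounded_linear "bop_apply A" by (rule bounded_linear_bop_apply)
  have "\<exists>z. \<forall>x. cinner (bop_apply A x) y = cinner x z" for y
  proof -
    have "bounded_linear (\<lambda>x. Re (cinner (bop_apply A x) y))"
    proof (rule bounded_linear_intro)
      fix x
      have "Re (cinner (bop_apply A x) y) \<le> norm (bop_apply A x) * norm y"
        by (rule Re_cinner_le)
      moreover have "- Re (cinner (bop_apply A x) y) \<le> norm (bop_apply A x) * norm y"
        using Re_cinner_le[of "- bop_apply A x" y] by (simp add: cinner_minus_left)
      ultimately show "norm (Re (cinner (bop_apply A x) y)) \<le> norm x * (norm A * norm y)"
        using mult_right_mono[OF norm_bop_apply[of A x] norm_ge_zero[of y]]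
        by (simp add: abs_le_iff mult.commute mult.left_commute)
    qed (simp_all add: A.add A.scaleR cinner_add_left cinner_scaleR_left)
    then obtain z where "\<And>x. Re (cinner (bop_apply A x) y) = Re (cinner x z)"
      by (rule riesz_real) blast
    from cinner_eqI_Re[OF this] show ?thesis
      by (auto simp: bop_apply_scaleC_right cinner_scaleC_left)
  qed
  then obtain T where T: "\<And>x y. cinner (bop_apply A x) y = cinner x (T y)"
    by metis
  have T_scaleC: "T (c *\<^sub>C y) = c *\<^sub>C T y" for c y
    by (rule cinner_right_cancel) (simp flip: T add: cinner_scaleC_right)
  have bl: "bounded_linear T"
  proof (rule bounded_linear_intro)
    show "T (y + z) = T y + T z" for y z
      by (rule cinner_right_cancel) (simp flip: T add: cinner_add_right)
    show "T (r *\<^sub>R y) = r *\<^sub>R T y" for r y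
      by (simp flip: scaleC_of_real add: T_scaleC)
    show "norm (T y) \<le> norm y * norm A" for y
    proof (rule norm_le_of_cinner_bound)
      show "Re (cinner x (T y)) \<le> norm y * norm A * norm x" for x
        unfolding T[symmetric]
        using Re_cinner_le[of "bop_apply A x" y]
          mult_right_mono[OF norm_bop_apply[of A x] norm_ge_zero[of y]]
        by (simp add: mult.commute mult.left_commute)
    qed simp
  qed
  have "bop_apply (Bop (Blinfun T)) = T"
    by (simp add: bop_apply.rep_eq Bop_inverse bounded_linear_Blinfun_apply bl T_scaleC)
  with T that show ?thesis by metis
qed

text \<open>As \<open>adj\<close> is a definite description, its defining property becomes available
  only after existence and uniqueness.\<close>

lemma cinner_adj: "cinner (bop_apply A x) y = cinner x (bop_apply (adj A) y)"
proof -
  have "\<exists>!B. \<forall>x y. cinner (bop_apply A x) y = cinner x (bop_apply B y)"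
    by (metis adjoint_exists bop_eqI cinner_right_cancel)
  from theI'[OF this] show ?thesis
    unfolding adj_def by blast
qed

lemma cinner_adj_left: "cinner (bop_apply A (bop_apply (adj A) y)) y = complex_of_real ((norm (bop_apply (adj A) y))\<^sup>2)"
  by (simp add: cinner_adj cinner_self)

lemma norm_le_norm_adj: "norm A \<le> norm (adj A)"
proof (rule norm_bop_bound)
  fix x
  let ?y = "bop_apply A x"
  have "(norm ?y)\<^sup>2 = Re (cinner x (bop_apply (adj A) ?y))"
    by (metis Re_cinner_self cinner_adj)
  also have "\<dots> \<le> norm x * (norm (adj A) * norm ?y)"
    by (rule order.trans[OF Re_cinner_le]) (simp add: mult_left_mono norm_bop_apply)
  finally show "norm ?y \<le> norm (adj A) * norm x"
    by (cases "?y = 0") (simp_all add: power2_eq_square mult.commute)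
qed simp

text \<open>Pairing the row sum with y gives the sum of the squares of
  \<open>norm (bop_apply (adj (X $ i)) y)\<close>, which dominates each summand. The bound is thus
  obtained for the adjoint of \<open>X $ j\<close> and passes to \<open>X $ j\<close> by
  \<open>norm_le_norm_adj\<close>.\<close>

lemma norm_component_le_row_norm:
  fixes X :: "'a::chilbert_space bop^'n::finite"
  shows "norm (X $ j) \<le> sqrt (norm (\<Sum>i\<in>UNIV. X $ i * adj (X $ i)))"
proof -
  let ?S = "\<Sum>i\<in>UNIV. X $ i * adj (X $ i)"
  have "norm (adj (X $ j)) \<le> sqrt (norm ?S)"
  proof (rule norm_bop_bound)
    fix y
    have "(norm (bop_apply (adj (X $ j)) y))\<^sup>2 \<le> (\<Sum>i\<in>UNIV. (norm (bop_apply (adj (X $ i)) y))\<^sup>2)"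
      by (rule member_le_sum) auto
    also have "\<dots> = Re (cinner (bop_apply ?S y) y)"
      by (simp add: bop_apply_sum_left cinner_sum_left bop_apply_times
          cinner_adj_left)
    also have "\<dots> \<le> norm (bop_apply ?S y) * norm y"
      by (rule Re_cinner_le)
    also have "\<dots> \<le> norm ?S * norm y * norm y"
      by (intro mult_right_mono norm_bop_apply) simp
    also have "\<dots> = (sqrt (norm ?S) * norm y)\<^sup>2"
      by (simp add: power_mult_distrib power2_eq_square)
    finally show "norm (bop_apply (adj (X $ j)) y) \<le> sqrt (norm ?S) * norm y"
      by (rule power2_le_imp_le) simp
  qed simp
  with norm_le_norm_adj show ?thesis by (rule order.trans)
qed

section \<open>Completeness and scalar multiplication\<close>

text \<open>Commuting with complex scalars survives pointwise limits, so the complex-linear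
  operators are closed among the real-linear ones. Completeness is what makes absolutely summable
  families of operators summable.\<close>

instance bop :: (chilbert_space) banach
proof
  fix S :: "nat \<Rightarrow> 'a bop"
  assume S: "Cauchy S"
  have "Cauchy (\<lambda>n. blinfun_of_bop (S n))"
    using S unfolding Cauchy_def dist_norm
    by (simp flip: norm_bop.rep_eq minus_bop.rep_eq)
  then obtain L where L: "(\<lambda>n. blinfun_of_bop (S n)) \<longlonglongrightarrow> L"
    using Cauchy_convergent convergent_def by blast
  have "blinfun_apply L (c *\<^sub>C x) = c *\<^sub>C blinfun_apply L x" for c x
  proof (rule LIMSEQ_unique)
    have lim: "(\<lambda>n. blinfun_apply (blinfun_of_bop (S n)) x) \<longlonglongrightarrow> blinfun_apply L x" for x
      by (intro tendsto_intros L)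
    show "(\<lambda>n. blinfun_apply (blinfun_of_bop (S n)) (c *\<^sub>C x)) \<longlonglongrightarrow> blinfun_apply L (c *\<^sub>C x)"
      by (rule lim)
    show "(\<lambda>n. blinfun_apply (blinfun_of_bop (S n)) (c *\<^sub>C x)) \<longlonglongrightarrow> c *\<^sub>C blinfun_apply L x"
      using bounded_linear.tendsto[OF bounded_linear_scaleC lim, of c x]
      by (simp add: bop_apply_scaleC_right flip: bop_apply.rep_eq)
  qed
  then have "blinfun_of_bop (Bop L) = L"
    by (simp add: Bop_inverse)
  then have "S \<longlonglongrightarrow> Bop L"
    using L unfolding LIMSEQ_def dist_norm
    by (metis minus_bop.rep_eq norm_bop.rep_eq)
  then show "convergent S"
    unfolding convergent_def by blast
qed

lemma bop_apply_one [simp]: "bop_apply 1 x = x"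
  by transfer simp

lemma bop_apply_scaleR_left: "bop_apply (r *\<^sub>R A) x = r *\<^sub>R bop_apply A x"
  by transfer (rule blinfun.scaleR_left)

text \<open>Only an inequality, since on the zero space the identity has norm 0.\<close>

lemma norm_bop_one_le: "norm (1 :: 'a::chilbert_space bop) \<le> 1"
  by (rule norm_bop_bound) simp_all

lemma norm_bop_scaleC_le: "norm (c *\<^sub>C (A :: 'a::chilbert_space bop)) \<le> cmod c * norm A"
  by (rule norm_bop_bound)
    (simp_all add: bop_apply_scaleC norm_scaleC mult.assoc mult_left_mono norm_bop_apply)

lemma bop_scaleC_scaleC: "c *\<^sub>C d *\<^sub>C A = (c * d) *\<^sub>C (A :: 'a::chilbert_space bop)"
  by (rule bop_eqI) (simp add: bop_apply_scaleC scaleC_scaleC)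

lemma bop_scaleC_add_left: "(c + d) *\<^sub>C A = c *\<^sub>C A + d *\<^sub>C (A :: 'a::chilbert_space bop)"
  by (rule bop_eqI) (simp add: bop_apply_scaleC bop_apply_add_left scaleC_add_left)

lemma bop_scaleC_one [simp]: "1 *\<^sub>C A = (A :: 'a::chilbert_space bop)"
  by (rule bop_eqI) (use scaleC_of_real[of 1] in \<open>simp add: bop_apply_scaleC\<close>)

lemma bop_scaleC_zero_left [simp]: "0 *\<^sub>C A = (0 :: 'a::chilbert_space bop)"
  using bop_scaleC_add_left[of 0 0 A] by simp

lemma bop_scaleC_sum_left: "sum c I *\<^sub>C A = (\<Sum>i\<in>I. c i *\<^sub>C (A :: 'a::chilbert_space bop))"
  by (induction I rule: infinite_finite_induct) (simp_all add: bop_scaleC_add_left)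

lemma bop_scaleC_mult_scaleC:
  "(c *\<^sub>C A) * (d *\<^sub>C B) = (c * d) *\<^sub>C (A * B :: 'a::chilbert_space bop)"
  by (rule bop_eqI)
    (simp add: bop_apply_scaleC bop_apply_times bop_apply_scaleC_right scaleC_scaleC mult.commute)

lemma bounded_linear_bop_scaleC: "bounded_linear (\<lambda>A :: 'a::chilbert_space bop. c *\<^sub>C A)"
proof (rule bounded_linear_intro)
  show "norm (c *\<^sub>C A) \<le> norm A * cmod c" for A :: "'a bop"
    using norm_bop_scaleC_le by (simp add: mult.commute)
qed (rule bop_eqI, simp add: bop_apply_scaleC bop_apply_add_left scaleC_add_right
    bop_apply_scaleR_left scaleC_scaleR_commute)+

section \<open>Words in operators\<close>

lemma op_word_Nil [simp]: "op_word X [] = 1"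
  by (simp add: op_word_def)

lemma op_word_Cons: "op_word X (i # \<alpha>) = X $ i * op_word X \<alpha>"
  by (simp add: op_word_def)

lemma op_word_append: "op_word X (\<alpha> @ \<beta>) = op_word X \<alpha> * op_word X \<beta>"
  by (simp add: op_word_def)

lemma norm_op_word_le:
  assumes "\<And>i. norm (X $ i) \<le> \<rho>"
  shows "norm (op_word X \<alpha>) \<le> \<rho> ^ length \<alpha>"
proof (induction \<alpha>)
  case Nil
  show ?case by (simp add: norm_bop_one_le)
next
  case (Cons i \<alpha>)
  have "norm (op_word X (i # \<alpha>)) \<le> norm (X $ i) * norm (op_word X \<alpha>)"
    unfolding op_word_Cons by (rule norm_mult_ineq)
  also have "\<dots> \<le> \<rho> * \<rho> ^ length \<alpha>"
    by (intro mult_mono assms Cons.IH) (use norm_ge_zero[of "X $ i"] assms[of i] in linarith, simp)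
  finally show ?case by simp
qed

lemma continuous_on_op_word [continuous_intros]: "continuous_on S (\<lambda>X. op_word X \<alpha>)"
  by (induction \<alpha>) (auto simp: op_word_Cons intro!: continuous_intros)

section \<open>Sums over words\<close>

lemma finite_words_length [simp]: "finite {\<alpha> :: 'n::finite list. length \<alpha> = k}"
  using finite_lists_length_eq[of "UNIV :: 'n set"] by simp

lemma finite_words_length_le [simp]: "finite {\<alpha> :: 'n::finite list. length \<alpha> \<le> k}"
  using finite_lists_length_le[of "UNIV :: 'n set"] by simp

text \<open>Grouping an unordered sum over words by length recovers the series in k that defines
  free holomorphic maps.\<close>

lemma has_sum_words_by_length:
  fixes h :: "'n::finite list \<Rightarrow> 'b::banach"
  assumes "(h has_sum s) UNIV"
  shows "(\<lambda>k. \<Sum>\<alpha> | length \<alpha> = k. h \<alpha>) sums s"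
proof -
  have bij: "bij_betw snd (SIGMA k:UNIV. {\<alpha>. length \<alpha> = k}) (UNIV :: 'n list set)"
    by (rule bij_betwI[where g = "\<lambda>\<alpha>. (length \<alpha>, \<alpha>)"]) auto
  have "((\<lambda>p. h (snd p)) has_sum s) (SIGMA k:UNIV. {\<alpha>. length \<alpha> = k})"
    using has_sum_reindex_bij_betw[OF bij, of h s] assms by simp
  then have "((\<lambda>k. \<Sum>\<alpha> | length \<alpha> = k. h \<alpha>) has_sum s) UNIV"
    by (rule has_sum_SigmaD) (auto intro!: has_sum_finiteI finite_words_length)
  then show ?thesis by (rule has_sum_imp_sums)
qed

text \<open>A word with a cut position is the same as a pair of words; this carries the index set of
  \<open>ncps_mult\<close> to that of a double sum.\<close>

lemma bij_betw_split_word: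
  "bij_betw (\<lambda>(w, k). (take k w, drop k w)) (SIGMA w:UNIV. {..length w}) UNIV"
  by (rule bij_betwI[where g = "\<lambda>(u, v). (u @ v, length u)"]) auto

text \<open>The family \<open>x u * y v\<close> is absolutely summable, so it may be summed row by
  row, giving the product of the sums, or grouped by the concatenation \<open>u @ v\<close>, giving
  the convolution.\<close>

lemma has_sum_words_Cauchy_product:
  fixes x y :: "'n list \<Rightarrow> 'b::{real_normed_algebra, banach}"
  assumes x: "x abs_summable_on UNIV" and y: "y abs_summable_on UNIV"
  shows "((\<lambda>w. \<Sum>k\<le>length w. x (take k w) * y (drop k w)) has_sum (infsum x UNIV * infsum y UNIV)) UNIV"
proof -
  have hs: "(x has_sum infsum x UNIV) UNIV" "(y has_sum infsum y UNIV) UNIV"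
    using x y by (simp_all add: abs_summable_summable)
  have "(\<lambda>(u, v). norm (x u) * norm (y v)) summable_on (UNIV \<times> UNIV)"
  proof (rule summable_on_SigmaI)
    show "((\<lambda>v. case (u, v) of (u, v) \<Rightarrow> norm (x u) * norm (y v)) has_sum
        norm (x u) * (\<Sum>\<^sub>\<infinity>v. norm (y v))) UNIV" for u
      using y by (auto intro!: has_sum_cmult_right)
    show "(\<lambda>u. norm (x u) * (\<Sum>\<^sub>\<infinity>v. norm (y v))) summable_on UNIV"
      using x by (rule summable_on_cmult_left)
  qed auto
  then have "(\<lambda>(u, v). x u * y v) abs_summable_on (UNIV \<times> UNIV)"
    by (rule Infinite_Sum.abs_summable_on_comparison_test') (auto simp: norm_mult_ineq)
  then have sm: "(\<lambda>(u, v). x u * y v) summable_on (UNIV \<times> UNIV)"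
    by (rule abs_summable_summable)
  have "((\<lambda>(u, v). x u * y v) has_sum (infsum x UNIV * infsum y UNIV)) (UNIV \<times> UNIV)"
  proof (rule has_sum_SigmaI[OF _ _ sm])
    show "((\<lambda>v. case (u, v) of (u, v) \<Rightarrow> x u * y v) has_sum x u * infsum y UNIV) UNIV" for u
      using hs(2) by (auto intro!: has_sum_cmult_right)
    show "((\<lambda>u. x u * infsum y UNIV) has_sum infsum x UNIV * infsum y UNIV) UNIV"
      using hs(1) by (rule has_sum_cmult_left)
  qed
  then have "((\<lambda>p. (\<lambda>(u, v). x u * y v) ((\<lambda>(w, k). (take k w, drop k w)) p)) has_sum
      (infsum x UNIV * infsum y UNIV)) (SIGMA w:UNIV. {..length w})"
    by (subst has_sum_reindex_bij_betw[OF bij_betw_split_word]) simp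
  then show ?thesis
    by (rule has_sum_SigmaD) (auto intro!: has_sum_finiteI)
qed

text \<open>There are \<open>CARD('n) ^ k\<close> words of length k, so grouping by length leaves a
  geometric series.\<close>

lemma summable_on_words_geometric:
  fixes q :: real
  assumes "0 \<le> q" "real CARD('n::finite) * q < 1"
  shows "(\<lambda>\<alpha> :: 'n list. q ^ length \<alpha>) summable_on UNIV"
proof -
  have bij: "bij_betw snd (SIGMA k:UNIV. {\<alpha>. length \<alpha> = k}) (UNIV :: 'n list set)"
    by (rule bij_betwI[where g = "\<lambda>\<alpha>. (length \<alpha>, \<alpha>)"]) auto
  have "(\<lambda>p. q ^ length (snd p)) summable_on (SIGMA k:UNIV. {\<alpha> :: 'n list. length \<alpha> = k})"
  proof (rule summable_on_SigmaI)
    show "((\<lambda>\<alpha>. q ^ length (snd (k, \<alpha>))) has_sum (real CARD('n) * q) ^ k) {\<alpha> :: 'n list. length \<alpha> = k}" for k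
      using finite_lists_length_eq[of "UNIV :: 'n set" k] card_lists_length_eq[of "UNIV :: 'n set" k]
      by (intro has_sum_finiteI) (auto simp: power_mult_distrib)
    show "(\<lambda>k. (real CARD('n) * q) ^ k) summable_on UNIV"
      using assms by (intro norm_summable_imp_summable_on) (simp add: summable_geometric)
  qed (use assms in auto)
  then show ?thesis
    using summable_on_reindex_bij_betw[OF bij, of "\<lambda>\<alpha>. q ^ length \<alpha>"] by simp
qed

section \<open>Absolutely convergent noncommutative power series\<close>

text \<open>A weighted l1 condition: it majorises the evaluation at every tuple with entries of norm
  at most \<open>\<rho>\<close>, and is preserved by products of series, where the associated
  \<open>ncps_norm\<close> is submultiplicative.\<close>

definition ncps_summable :: "real \<Rightarrow> 'n ncps \<Rightarrow> bool"
  where "ncps_summable \<rho> F \<longleftrightarrow> (\<lambda>\<alpha>. cmod (F \<alpha>) * \<rho> ^ length \<alpha>) summable_on UNIV"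

definition ncps_norm :: "real \<Rightarrow> 'n ncps \<Rightarrow> real"
  where "ncps_norm \<rho> F = (\<Sum>\<^sub>\<infinity>\<alpha>. cmod (F \<alpha>) * \<rho> ^ length \<alpha>)"

text \<open>An unordered sum over words, so that sums may be rearranged freely;
  \<open>hom_part_sums_ncps_eval\<close> identifies it with the sum of homogeneous parts.\<close>

definition ncps_eval :: "'n ncps \<Rightarrow> 'a::chilbert_space bop^'n \<Rightarrow> 'a bop"
  where "ncps_eval F X = (\<Sum>\<^sub>\<infinity>\<alpha>. F \<alpha> *\<^sub>C op_word X \<alpha>)"

lemma ncps_norm_nonneg: "0 \<le> \<rho> \<Longrightarrow> 0 \<le> ncps_norm \<rho> F"
  unfolding ncps_norm_def by (intro infsum_nonneg) simp

lemma norm_ncps_term_le: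
  assumes "\<And>i. norm (X $ i) \<le> \<rho>"
  shows "norm (F \<alpha> *\<^sub>C op_word X \<alpha>) \<le> cmod (F \<alpha>) * \<rho> ^ length \<alpha>"
  by (rule order.trans[OF norm_bop_scaleC_le]) (simp add: mult_left_mono norm_op_word_le assms)

lemma abs_summable_ncps_terms:
  fixes X :: "'a::chilbert_space bop^'n"
  assumes "ncps_summable \<rho> F" "\<And>i. norm (X $ i) \<le> \<rho>"
  shows "(\<lambda>\<alpha>. F \<alpha> *\<^sub>C op_word X \<alpha>) abs_summable_on UNIV"
  using assms(1) unfolding ncps_summable_def
  by (rule Infinite_Sum.abs_summable_on_comparison_test') (rule norm_ncps_term_le[OF assms(2)])

lemma has_sum_ncps_eval:
  fixes X :: "'a::chilbert_space bop^'n"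
  assumes "ncps_summable \<rho> F" "\<And>i. norm (X $ i) \<le> \<rho>"
  shows "((\<lambda>\<alpha>. F \<alpha> *\<^sub>C op_word X \<alpha>) has_sum ncps_eval F X) UNIV"
  unfolding ncps_eval_def using abs_summable_ncps_terms[OF assms] by (simp add: abs_summable_summable)

lemma norm_ncps_eval_le:
  fixes X :: "'a::chilbert_space bop^'n"
  assumes "ncps_summable \<rho> F" "\<And>i. norm (X $ i) \<le> \<rho>"
  shows "norm (ncps_eval F X) \<le> ncps_norm \<rho> F"
proof -
  have "norm (ncps_eval F X) \<le> (\<Sum>\<^sub>\<infinity>\<alpha>. norm (F \<alpha> *\<^sub>C op_word X \<alpha>))"
    unfolding ncps_eval_def by (rule norm_infsum_bound[OF abs_summable_ncps_terms[OF assms]])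
  also have "\<dots> \<le> ncps_norm \<rho> F"
    unfolding ncps_norm_def using assms(1) norm_ncps_term_le[OF assms(2)]
    by (intro infsum_mono abs_summable_ncps_terms[OF assms]) (simp_all add: ncps_summable_def)
  finally show ?thesis .
qed

lemma hom_part_sums_ncps_eval:
  fixes X :: "'a::chilbert_space bop^'n::finite"
  assumes "ncps_summable \<rho> F" "\<And>i. norm (X $ i) \<le> \<rho>"
  shows "hom_part F X sums ncps_eval F X"
  using has_sum_words_by_length[OF has_sum_ncps_eval[OF assms]]
  unfolding hom_part_def[abs_def] .

text \<open>The Weierstrass M-test makes the finite partial sums, which are continuous, converge
  uniformly on the closed polyball. This gives openness of the domains below.\<close>

lemma continuous_on_ncps_eval:
  fixes F :: "'n::finite ncps"
  assumes "ncps_summable \<rho> F"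
  shows "continuous_on {X :: 'a::chilbert_space bop^'n. \<forall>i. norm (X $ i) \<le> \<rho>} (ncps_eval F)"
proof (rule uniform_limit_theorem)
  let ?B = "{X :: 'a bop^'n. \<forall>i. norm (X $ i) \<le> \<rho>}"
  show "uniform_limit ?B (\<lambda>A X. \<Sum>\<alpha>\<in>A. F \<alpha> *\<^sub>C op_word X \<alpha>) (ncps_eval F) (finite_subsets_at_top UNIV)"
    unfolding ncps_eval_def[abs_def]
    using assms unfolding ncps_summable_def
    by (intro Weierstrass_m_test_general) (auto intro: norm_ncps_term_le)
  have "continuous_on ?B (\<lambda>X. F \<alpha> *\<^sub>C op_word X \<alpha>)" for \<alpha>
    by (rule continuous_on_compose2[OF linear_continuous_on[OF bounded_linear_bop_scaleC]
          continuous_on_op_word]) auto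
  then show "\<forall>\<^sub>F A in finite_subsets_at_top UNIV. continuous_on ?B (\<lambda>X. \<Sum>\<alpha>\<in>A. F \<alpha> *\<^sub>C op_word X \<alpha>)"
    by (intro always_eventually allI continuous_on_sum)
qed simp

lemma ncps_mono:
  assumes "ncps_summable \<rho> F" "0 \<le> \<sigma>" "\<sigma> \<le> \<rho>"
  shows "ncps_summable \<sigma> F"
proof -
  have "(\<lambda>\<alpha>. norm (cmod (F \<alpha>) * \<sigma> ^ length \<alpha>)) summable_on UNIV"
    using assms(1) unfolding ncps_summable_def
    by (rule Infinite_Sum.abs_summable_on_comparison_test')
      (use assms in \<open>auto intro!: mult_left_mono power_mono simp: abs_mult power_abs\<close>)
  then show ?thesis
    using assms(2) by (simp add: ncps_summable_def abs_mult power_abs)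
qed

text \<open>Every word that contributes is nonempty, so shrinking the radius from
  \<open>\<rho>\<close> to \<open>\<sigma>\<close> gains at least one factor
  \<open>\<sigma> / \<rho>\<close>.\<close>

lemma ncps_norm_scale_le:
  assumes F: "ncps_summable \<rho> F" "F [] = 0" and \<sigma>: "0 \<le> \<sigma>" "\<sigma> \<le> \<rho>" "0 < \<rho>"
  shows "ncps_norm \<sigma> F \<le> \<sigma> / \<rho> * ncps_norm \<rho> F"
proof -
  have le: "cmod (F \<alpha>) * \<sigma> ^ length \<alpha> \<le> \<sigma> / \<rho> * (cmod (F \<alpha>) * \<rho> ^ length \<alpha>)" for \<alpha>
  proof (cases \<alpha>)
    case (Cons i \<beta>)
    have "\<sigma> ^ length \<beta> \<le> \<rho> ^ length \<beta>"
      using \<sigma> by (intro power_mono)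
    then have "cmod (F \<alpha>) * (\<sigma> * \<sigma> ^ length \<beta>) \<le> cmod (F \<alpha>) * (\<sigma> * \<rho> ^ length \<beta>)"
      using \<sigma> by (simp add: mult_left_mono)
    also have "\<dots> = \<sigma> / \<rho> * (cmod (F \<alpha>) * \<rho> ^ length \<alpha>)"
      using \<sigma> by (simp add: Cons)
    finally show ?thesis by (simp add: Cons)
  qed (simp add: F)
  show ?thesis
    unfolding ncps_norm_def infsum_cmult_right'[symmetric]
    using ncps_mono[OF F(1) \<sigma>(1,2)] F(1) unfolding ncps_summable_def
    by (intro infsum_mono summable_on_cmult_right le)
qed

section \<open>Products, words and composition of series\<close>

lemma ncps_mult_summable:
  assumes \<rho>: "0 \<le> \<rho>" and a: "ncps_summable \<rho> a" and b: "ncps_summable \<rho> b"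
  shows "ncps_summable \<rho> (ncps_mult a b)"
    and "ncps_norm \<rho> (ncps_mult a b) \<le> ncps_norm \<rho> a * ncps_norm \<rho> b"
proof -
  let ?x = "\<lambda>a \<alpha>. cmod (a \<alpha>) * \<rho> ^ length \<alpha>"
  let ?z = "\<lambda>w. \<Sum>k\<le>length w. ?x a (take k w) * ?x b (drop k w)"
  have z: "(?z has_sum (ncps_norm \<rho> a * ncps_norm \<rho> b)) UNIV"
    unfolding ncps_norm_def
    by (rule has_sum_words_Cauchy_product)
      (use \<rho> a b in \<open>simp_all add: ncps_summable_def abs_mult power_abs\<close>)
  have le: "?x (ncps_mult a b) w \<le> ?z w" for w
  proof -
    have "?x (ncps_mult a b) w \<le> (\<Sum>k\<le>length w. cmod (a (take k w)) * cmod (b (drop k w))) * \<rho> ^ length w"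
      unfolding ncps_mult_def using \<rho>
      by (intro mult_right_mono sum_norm_le) (simp_all add: norm_mult)
    \<comment> \<open>The two halves of a cut word have lengths adding up to
      \<open>length w\<close>, so the power of \<open>\<rho>\<close> splits accordingly.\<close>
    also have "\<dots> = ?z w"
      unfolding sum_distrib_right by (intro sum.cong) (auto simp: mult_ac simp flip: power_add)
    finally show ?thesis .
  qed
  have "(\<lambda>w. norm (?x (ncps_mult a b) w)) summable_on UNIV"
    by (rule Infinite_Sum.abs_summable_on_comparison_test'[of ?z])
      (use z le \<rho> in \<open>auto simp: abs_mult power_abs summable_on_def\<close>)
  then show *: "ncps_summable \<rho> (ncps_mult a b)"
    using \<rho> by (simp add: ncps_summable_def abs_mult power_abs)
  show "ncps_norm \<rho> (ncps_mult a b) \<le> ncps_norm \<rho> a * ncps_norm \<rho> b"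
    unfolding ncps_norm_def[of _ "ncps_mult a b"]
    by (rule has_sum_mono[OF has_sum_infsum z le]) (use * in \<open>simp add: ncps_summable_def\<close>)
qed

lemma ncps_eval_mult:
  fixes X :: "'a::chilbert_space bop^'n"
  assumes "ncps_summable \<rho> a" "ncps_summable \<rho> b" "\<And>i. norm (X $ i) \<le> \<rho>"
  shows "ncps_eval (ncps_mult a b) X = ncps_eval a X * ncps_eval b X"
proof -
  have "(\<Sum>k\<le>length w. (a (take k w) *\<^sub>C op_word X (take k w)) * (b (drop k w) *\<^sub>C op_word X (drop k w)))
      = ncps_mult a b w *\<^sub>C op_word X w" for w
    by (simp add: ncps_mult_def bop_scaleC_sum_left bop_scaleC_mult_scaleC flip: op_word_append)
  with has_sum_words_Cauchy_product[OF abs_summable_ncps_terms[OF assms(1,3)] abs_summable_ncps_terms[OF assms(2,3)]]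
  show ?thesis
    unfolding ncps_eval_def by (simp add: infsumI)
qed

lemma has_sum_only_Nil:
  fixes h :: "'n list \<Rightarrow> 'b::{comm_monoid_add, topological_space}"
  assumes "\<And>w. w \<noteq> [] \<Longrightarrow> h w = 0"
  shows "(h has_sum h []) UNIV"
  using has_sum_finiteI[of "{[]}" "h []" h] has_sum_cong_neutral[of "UNIV" "{[]}" h h] assms by auto

lemma ncps_one_summable:
  "ncps_summable \<rho> (ncps_one :: 'n ncps)" "ncps_norm \<rho> (ncps_one :: 'n ncps) = 1"
proof -
  let ?h = "\<lambda>\<alpha> :: 'n list. cmod (ncps_one \<alpha>) * \<rho> ^ length \<alpha>"
  have "(?h has_sum ?h []) UNIV"
    by (rule has_sum_only_Nil) (simp add: ncps_one_def)
  then have "(?h has_sum 1) UNIV"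
    by (simp add: ncps_one_def)
  then show "ncps_summable \<rho> (ncps_one :: 'n ncps)" "ncps_norm \<rho> (ncps_one :: 'n ncps) = 1"
    unfolding ncps_summable_def ncps_norm_def by (auto simp: summable_on_def intro: infsumI)
qed

lemma ncps_eval_one: "ncps_eval ncps_one X = 1"
proof -
  let ?h = "\<lambda>\<alpha>. ncps_one \<alpha> *\<^sub>C op_word X \<alpha>"
  have "(?h has_sum ?h []) UNIV"
    by (rule has_sum_only_Nil) (simp add: ncps_one_def)
  then show ?thesis
    unfolding ncps_eval_def by (simp add: ncps_one_def infsumI)
qed

lemma ncps_word_Nil: "ncps_word g [] = ncps_one"
  by (simp add: ncps_word_def)

lemma ncps_word_Cons: "ncps_word g (i # \<alpha>) = ncps_mult (g i) (ncps_word g \<alpha>)"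
  by (simp add: ncps_word_def)

lemma ncps_word_summable:
  assumes "0 \<le> \<rho>" "\<And>i. ncps_summable \<rho> (g i)" "\<And>i. ncps_norm \<rho> (g i) \<le> \<sigma>"
  shows "ncps_summable \<rho> (ncps_word g \<alpha>) \<and> ncps_norm \<rho> (ncps_word g \<alpha>) \<le> \<sigma> ^ length \<alpha>"
proof (induction \<alpha>)
  case Nil
  show ?case by (simp add: ncps_word_Nil ncps_one_summable)
next
  case (Cons i \<alpha>)
  have "0 \<le> \<sigma>"
    using ncps_norm_nonneg[OF assms(1)] assms(3) order.trans by blast
  have "ncps_norm \<rho> (ncps_word g (i # \<alpha>)) \<le> ncps_norm \<rho> (g i) * ncps_norm \<rho> (ncps_word g \<alpha>)"
    using Cons.IH assms by (simp add: ncps_word_Cons ncps_mult_summable)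
  also have "\<dots> \<le> \<sigma> * \<sigma> ^ length \<alpha>"
    using Cons.IH assms \<open>0 \<le> \<sigma>\<close> by (intro mult_mono ncps_norm_nonneg) auto
  finally show ?case
    using Cons.IH assms by (simp add: ncps_word_Cons ncps_mult_summable)
qed

lemma ncps_eval_word:
  fixes X :: "'a::chilbert_space bop^'m" and g :: "'n::finite \<Rightarrow> 'm ncps"
  assumes "0 \<le> \<rho>" "\<And>i. ncps_summable \<rho> (g i)" "\<And>i. norm (X $ i) \<le> \<rho>"
  shows "ncps_summable \<rho> (ncps_word g \<alpha>) \<and>
    ncps_eval (ncps_word g \<alpha>) X = op_word (\<chi> i. ncps_eval (g i) X) \<alpha>"
proof (induction \<alpha>)
  case Nil
  show ?case by (simp add: ncps_word_Nil ncps_one_summable ncps_eval_one)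
next
  case (Cons i \<alpha>)
  then show ?case
    using assms
    by (simp add: ncps_word_Cons op_word_Cons ncps_mult_summable ncps_eval_mult[of \<rho>])
qed

text \<open>Without constant terms, each letter of \<open>\<alpha>\<close> must absorb at least one
  letter of w. Hence the cut-off in \<open>ncps_compose\<close> discards only zeros.\<close>

lemma ncps_word_eq_0:
  assumes "\<And>i. g i [] = 0" "length w < length \<alpha>"
  shows "ncps_word g \<alpha> w = 0"
  using assms(2)
proof (induction \<alpha> arbitrary: w)
  case (Cons i \<alpha>)
  have "g i (take k w) * ncps_word g \<alpha> (drop k w) = 0" if "k \<le> length w" for k
  proof (cases k)
    case 0
    then show ?thesis by (simp add: assms(1))
  next
    case (Suc l)
    then show ?thesis using that Cons.prems by (simp add: Cons.IH)
  qed
  then show ?case by (auto simp: ncps_word_Cons ncps_mult_def intro!: sum.neutral)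
qed simp

text \<open>Fubini for the double family \<open>P\<close>: summing over w first evaluates F at the
  tuple g(X), summing over \<open>\<alpha>\<close> first evaluates the formal composition at
  X.\<close>

lemma ncps_eval_compose:
  fixes X :: "'a::chilbert_space bop^'m::finite" and g :: "'n::finite \<Rightarrow> 'm ncps"
  assumes \<rho>: "0 \<le> \<rho>" and g: "\<And>i. ncps_summable \<rho> (g i)" "\<And>i. ncps_norm \<rho> (g i) \<le> \<sigma>" "\<And>i. g i [] = 0"
    and F: "ncps_summable \<sigma> F" and X: "\<And>i. norm (X $ i) \<le> \<rho>"
  shows "ncps_eval (ncps_compose F g) X = ncps_eval F (\<chi> i. ncps_eval (g i) X)"
proof -
  define P where "P \<alpha> w = F \<alpha> *\<^sub>C ncps_word g \<alpha> w *\<^sub>C op_word X w" for \<alpha> w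
  have word: "ncps_summable \<rho> (ncps_word g \<alpha>)" "ncps_norm \<rho> (ncps_word g \<alpha>) \<le> \<sigma> ^ length \<alpha>" for \<alpha>
    using ncps_word_summable[of \<rho> g \<sigma>] \<rho> g by simp_all
  have "(\<lambda>(\<alpha>, w). cmod (F \<alpha>) * (cmod (ncps_word g \<alpha> w) * \<rho> ^ length w)) summable_on (UNIV \<times> UNIV)"
  proof (rule summable_on_SigmaI)
    show "((\<lambda>w. case (\<alpha>, w) of (\<alpha>, w) \<Rightarrow> cmod (F \<alpha>) * (cmod (ncps_word g \<alpha> w) * \<rho> ^ length w)) has_sum
        cmod (F \<alpha>) * ncps_norm \<rho> (ncps_word g \<alpha>)) UNIV" for \<alpha>
      using word(1)[of \<alpha>] unfolding ncps_norm_def ncps_summable_def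
      by (auto intro!: has_sum_cmult_right)
    \<comment> \<open>The row of \<open>\<alpha>\<close> sums to at most
      \<open>cmod (F \<alpha>) * \<sigma> ^ length \<alpha>\<close>, which is why F has to be
      summable at the bound \<open>\<sigma>\<close> for the inner norms.\<close>
    have "(\<lambda>\<alpha>. norm (cmod (F \<alpha>) * ncps_norm \<rho> (ncps_word g \<alpha>))) summable_on UNIV"
      using F unfolding ncps_summable_def
      by (rule Infinite_Sum.abs_summable_on_comparison_test')
        (use word(2) in \<open>auto intro!: mult_left_mono simp: abs_mult abs_of_nonneg[OF ncps_norm_nonneg[OF \<rho>]]\<close>)
    then show "(\<lambda>\<alpha>. cmod (F \<alpha>) * ncps_norm \<rho> (ncps_word g \<alpha>)) summable_on UNIV"
      by (simp add: abs_mult ncps_norm_nonneg[OF \<rho>])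
  qed (use \<rho> in auto)
  then have "(\<lambda>(\<alpha>, w). P \<alpha> w) abs_summable_on (UNIV \<times> UNIV)"
  proof (rule Infinite_Sum.abs_summable_on_comparison_test')
    fix p :: "'n list \<times> 'm list"
    obtain \<alpha> w where p: "p = (\<alpha>, w)" by fastforce
    have "norm (P \<alpha> w) \<le> cmod (F \<alpha>) * (cmod (ncps_word g \<alpha> w) * \<rho> ^ length w)"
      unfolding P_def
      by (rule order.trans[OF norm_bop_scaleC_le mult_left_mono[OF norm_ncps_term_le[OF X]]]) simp
    then show "norm (case p of (\<alpha>, w) \<Rightarrow> P \<alpha> w) \<le>
        (case p of (\<alpha>, w) \<Rightarrow> cmod (F \<alpha>) * (cmod (ncps_word g \<alpha> w) * \<rho> ^ length w))"
      by (simp add: p)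
  qed
  then have swap: "(\<Sum>\<^sub>\<infinity>\<alpha>. \<Sum>\<^sub>\<infinity>w. P \<alpha> w) = (\<Sum>\<^sub>\<infinity>w. \<Sum>\<^sub>\<infinity>\<alpha>. P \<alpha> w)"
    by (rule infsum_swap_banach[OF abs_summable_summable])
  have "(\<Sum>\<^sub>\<infinity>w. P \<alpha> w) = F \<alpha> *\<^sub>C op_word (\<chi> i. ncps_eval (g i) X) \<alpha>" for \<alpha>
  proof -
    have "((\<lambda>w. ncps_word g \<alpha> w *\<^sub>C op_word X w) has_sum op_word (\<chi> i. ncps_eval (g i) X) \<alpha>) UNIV"
      using has_sum_ncps_eval[OF word(1)[of \<alpha>] X] ncps_eval_word[where g = g and \<alpha> = \<alpha>, OF \<rho> g(1) X]
      by simp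
    from has_sum_bounded_linear[OF bounded_linear_bop_scaleC this] show ?thesis
      unfolding P_def by (rule infsumI)
  qed
  moreover have "(\<Sum>\<^sub>\<infinity>\<alpha>. P \<alpha> w) = ncps_compose F g w *\<^sub>C op_word X w" for w
  proof -
    have "(\<Sum>\<^sub>\<infinity>\<alpha>. P \<alpha> w) = (\<Sum>\<^sub>\<infinity>\<alpha>\<in>{\<alpha>. length \<alpha> \<le> length w}. P \<alpha> w)"
      by (rule infsum_cong_neutral)
        (simp_all add: P_def ncps_word_eq_0[where g = g, OF g(3)]
          linear_0[OF bounded_linear.linear[OF bounded_linear_bop_scaleC]])
    also have "\<dots> = ncps_compose F g w *\<^sub>C op_word X w"
      by (simp add: P_def ncps_compose_def bop_scaleC_scaleC bop_scaleC_sum_left)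
    finally show ?thesis .
  qed
  ultimately show ?thesis
    using swap unfolding ncps_eval_def by simp
qed

lemma ncps_eval_var: "ncps_eval (ncps_var i) X = X $ i"
proof -
  have "(\<Sum>\<^sub>\<infinity>\<alpha>. ncps_var i \<alpha> *\<^sub>C op_word X \<alpha>) = (\<Sum>\<^sub>\<infinity>\<alpha>\<in>{[i]}. ncps_var i \<alpha> *\<^sub>C op_word X \<alpha>)"
    by (rule infsum_cong_neutral) (auto simp: ncps_var_def)
  then show ?thesis
    unfolding ncps_eval_def by (simp add: ncps_var_def op_word_Cons)
qed

section \<open>From the radius of convergence to absolute summability\<close>

lemma ncps_coeff_bound:
  assumes "ncps_radius F \<noteq> 0"
  obtains C M where "0 < C" "0 < M" "\<And>\<alpha>. cmod (F \<alpha>) \<le> C * M ^ length \<alpha>"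
proof -
  define S where "S k = (\<Sum>\<alpha> | length \<alpha> = k. (cmod (F \<alpha>))\<^sup>2)" for k
  have "limsup (\<lambda>k. ereal (root (2 * k) (S k))) < \<infinity>"
    using assms unfolding ncps_radius_def S_def by (auto simp: less_top[symmetric])
  then obtain M0 where "limsup (\<lambda>k. ereal (root (2 * k) (S k))) < ereal M0"
    using ereal_dense2 by blast
  then have ev: "\<forall>\<^sub>F k in sequentially. root (2 * k) (S k) < M0"
    by (auto dest: Limsup_lessD)
  define M where "M = \<bar>M0\<bar> + 1"
  have "M > 0" by (simp add: M_def)
  obtain N where N: "\<And>k. k \<ge> N \<Longrightarrow> root (2 * k) (S k) < M0"
    using ev by (auto simp: eventually_sequentially)
  \<comment> \<open>The sum absorbs the finitely many words of length up to N; the added 1 gives C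
    at least 1, so that the bound \<open>M ^ length \<alpha>\<close> for longer words is covered
    too.\<close>
  define C where "C = (\<Sum>\<alpha> | length \<alpha> \<le> N. cmod (F \<alpha>) / M ^ length \<alpha>) + 1"
  have "C \<ge> 1" using \<open>M > 0\<close> by (simp add: C_def sum_nonneg)
  have "cmod (F \<alpha>) \<le> C * M ^ length \<alpha>" for \<alpha>
  proof (cases "length \<alpha> \<le> N")
    case True
    then have "cmod (F \<alpha>) / M ^ length \<alpha> \<le> (\<Sum>\<alpha> | length \<alpha> \<le> N. cmod (F \<alpha>) / M ^ length \<alpha>)"
      using \<open>M > 0\<close> by (intro member_le_sum[of \<alpha> _ "\<lambda>\<alpha>. cmod (F \<alpha>) / M ^ length \<alpha>"]) simp_all
    then have "cmod (F \<alpha>) / M ^ length \<alpha> \<le> C" by (simp add: C_def)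
    then show ?thesis using \<open>M > 0\<close> by (simp add: pos_divide_le_eq)
  next
    case False
    let ?k = "length \<alpha>"
    \<comment> \<open>Needed because \<open>root 0\<close> is constantly 0 and its powers recover
      nothing.\<close>
    have "?k > 0" using False by (cases \<alpha>) auto
    have "S ?k \<ge> 0" by (simp add: S_def sum_nonneg)
    have "S ?k = root (2 * ?k) (S ?k) ^ (2 * ?k)"
      using \<open>?k > 0\<close> \<open>S ?k \<ge> 0\<close> by (simp add: real_root_pow_pos2)
    also have "\<dots> \<le> M ^ (2 * ?k)"
      using N[of ?k] False \<open>S ?k \<ge> 0\<close> by (intro power_mono) (auto simp: M_def real_root_ge_zero)
    finally have "S ?k \<le> (M ^ ?k)\<^sup>2" by (simp add: power_mult mult.commute)
    moreover have "(cmod (F \<alpha>))\<^sup>2 \<le> S ?k"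
      unfolding S_def by (rule member_le_sum[of \<alpha> _ "\<lambda>\<alpha>. (cmod (F \<alpha>))\<^sup>2"]) simp_all
    ultimately have "(cmod (F \<alpha>))\<^sup>2 \<le> (M ^ ?k)\<^sup>2" by (rule order.trans[rotated])
    then have "cmod (F \<alpha>) \<le> M ^ ?k"
      by (rule power2_le_imp_le) (use \<open>M > 0\<close> in simp)
    also have "\<dots> \<le> C * M ^ ?k"
      using \<open>C \<ge> 1\<close> \<open>M > 0\<close> by simp
    finally show ?thesis .
  qed
  with \<open>C \<ge> 1\<close> \<open>M > 0\<close> show ?thesis by (intro that[of C M]) auto
qed

lemma ncps_summable_of_radius:
  fixes F :: "'n::finite ncps"
  assumes "ncps_radius F \<noteq> 0"
  obtains \<rho> where "0 < \<rho>" "ncps_summable \<rho> F"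
proof -
  obtain C M where CM: "0 < C" "0 < M" "\<And>\<alpha>. cmod (F \<alpha>) \<le> C * M ^ length \<alpha>"
    using ncps_coeff_bound[OF assms] by blast
  \<comment> \<open>With this q the ratio \<open>CARD('n) * q\<close> of the geometric series is
    1/2, and the radius \<open>q / M\<close> cancels the growth of the coefficients.\<close>
  define q where "q = 1 / (2 * real CARD('n))"
  have q: "0 < q" "real CARD('n) * q < 1" by (simp_all add: q_def)
  have "(\<lambda>\<alpha> :: 'n list. C * q ^ length \<alpha>) summable_on UNIV"
    using q by (intro summable_on_cmult_right summable_on_words_geometric) simp_all
  then have "(\<lambda>\<alpha>. norm (cmod (F \<alpha>) * (q / M) ^ length \<alpha>)) summable_on UNIV"
  proof (rule Infinite_Sum.abs_summable_on_comparison_test')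
    fix \<alpha>
    have "cmod (F \<alpha>) * (q / M) ^ length \<alpha> \<le> C * M ^ length \<alpha> * (q / M) ^ length \<alpha>"
      using CM q by (intro mult_right_mono) simp_all
    also have "\<dots> = C * q ^ length \<alpha>"
      using CM by (simp add: power_divide)
    finally show "norm (cmod (F \<alpha>) * (q / M) ^ length \<alpha>) \<le> C * q ^ length \<alpha>"
      using CM q by (simp add: abs_mult power_abs)
  qed
  then have "ncps_summable (q / M) F"
    using CM q by (simp add: ncps_summable_def abs_mult power_abs)
  with CM q that show ?thesis by (meson divide_pos_pos)
qed

lemma ncps_summable_of_tuple_radius:
  fixes f :: "'n::finite \<Rightarrow> 'n ncps"
  assumes "tuple_radius f \<noteq> 0"
  obtains \<rho> where "0 < \<rho>" "\<And>i. ncps_summable \<rho> (f i)"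
proof -
  \<comment> \<open>A nonzero minimum excludes a zero component only once all radii are known to be
    nonnegative.\<close>
  have nonneg: "0 \<le> ncps_radius (f i)" for i
  proof -
    have "0 \<le> limsup (\<lambda>k. ereal (root (2 * k) (\<Sum>\<alpha> | length \<alpha> = k. (cmod (f i \<alpha>))\<^sup>2)))"
      by (rule le_Limsup) (auto intro!: always_eventually real_root_ge_zero sum_nonneg)
    then show ?thesis unfolding ncps_radius_def by (rule iffD2[OF ereal_inverse_nonneg_iff, OF disjI1])
  qed
  have "ncps_radius (f i) \<noteq> 0" for i
  proof
    assume 0: "ncps_radius (f i) = 0"
    have "tuple_radius f \<le> ncps_radius (f i)"
      unfolding tuple_radius_def by (intro Min_le) auto
    moreover have "0 \<le> tuple_radius f"
      unfolding tuple_radius_def using nonneg by (subst Min_ge_iff) auto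
    ultimately show False using 0 assms by simp
  qed
  then have "\<forall>i. \<exists>\<rho>>0. ncps_summable \<rho> (f i)"
    by (metis ncps_summable_of_radius)
  then obtain r where r: "\<And>i. 0 < r i" "\<And>i. ncps_summable (r i) (f i)"
    by metis
  define \<rho> where "\<rho> = Min (range r)"
  have "0 < \<rho>" unfolding \<rho>_def using r by (subst Min_gr_iff) auto
  have "\<rho> \<le> r i" for i unfolding \<rho>_def by (intro Min_le) auto
  then have "ncps_summable \<rho> (f i)" for i
    using ncps_mono[OF r(2)[of i]] \<open>0 < \<rho>\<close> by simp
  with \<open>0 < \<rho>\<close> that show ?thesis by blast
qed

lemma ncps_norm_small:
  fixes f :: "'n::finite \<Rightarrow> 'n ncps"
  assumes \<rho>: "0 < \<rho>" "\<And>i. ncps_summable \<rho> (f i)" and f: "zero_const f" and "0 < \<epsilon>"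
  obtains \<sigma> where "0 < \<sigma>" "\<sigma> \<le> \<rho>" "\<And>\<tau> i. 0 \<le> \<tau> \<Longrightarrow> \<tau> \<le> \<sigma> \<Longrightarrow> ncps_norm \<tau> (f i) < \<epsilon>"
proof -
  define K where "K = (\<Sum>i\<in>UNIV. ncps_norm \<rho> (f i)) + 1"
  have K: "ncps_norm \<rho> (f i) < K" "0 < K" for i
  proof -
    have "ncps_norm \<rho> (f i) \<le> (\<Sum>i\<in>UNIV. ncps_norm \<rho> (f i))"
      using \<rho> by (intro member_le_sum) (simp_all add: ncps_norm_nonneg)
    then show "ncps_norm \<rho> (f i) < K" by (simp add: K_def)
    with ncps_norm_nonneg[of \<rho> "f i"] \<rho> show "0 < K" by linarith
  qed
  \<comment> \<open>The second entry makes \<open>\<tau> / \<rho> * K\<close> at most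
    \<open>\<epsilon>\<close>. Since \<open>K\<close> strictly exceeds every norm, strictness
    follows for positive \<open>\<tau>\<close>; the case \<open>\<tau> = 0\<close> is
    separate.\<close>
  define \<sigma> where "\<sigma> = min \<rho> (\<epsilon> * \<rho> / K)"
  have \<sigma>: "0 < \<sigma>" "\<sigma> \<le> \<rho>" "\<sigma> \<le> \<epsilon> * \<rho> / K"
    using \<rho> K \<open>0 < \<epsilon>\<close> by (simp_all add: \<sigma>_def)
  have "ncps_norm \<tau> (f i) < \<epsilon>" if \<tau>: "0 \<le> \<tau>" "\<tau> \<le> \<sigma>" for \<tau> i
  proof (cases "\<tau> = 0")
    case True
    have "ncps_norm 0 (f i) \<le> 0 / \<rho> * ncps_norm \<rho> (f i)"
      using \<rho> f by (intro ncps_norm_scale_le) (simp_all add: zero_const_def)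
    then show ?thesis using True \<open>0 < \<epsilon>\<close> by simp
  next
    case False
    have "ncps_norm \<tau> (f i) \<le> \<tau> / \<rho> * ncps_norm \<rho> (f i)"
      using \<rho> f \<sigma> \<tau> by (intro ncps_norm_scale_le) (simp_all add: zero_const_def)
    also have "\<dots> < \<tau> / \<rho> * K"
      using False \<tau> \<rho> K by (intro mult_strict_left_mono) simp_all
    also have "\<dots> \<le> \<epsilon>"
      using mult_right_mono[OF order.trans[OF \<tau>(2) \<sigma>(3)], of K] \<rho> K by (simp add: field_simps)
    finally show ?thesis .
  qed
  with \<sigma> that show ?thesis by blast
qed

section \<open>The inverse mapping\<close>

lemma norm_component_less_of_op_ball: "X \<in> op_ball r \<Longrightarrow> norm (X $ i) < r"
  using norm_component_le_row_norm[of X i] by (simp add: op_ball_def)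

lemma zero_in_op_ball: "0 < r \<Longrightarrow> 0 \<in> op_ball r"
  by (simp add: op_ball_def)

lemma ncps_eval_inverse:
  fixes X :: "'a::chilbert_space bop^'n::finite"
  assumes "\<And>i. ncps_compose (g i) f = ncps_var i" "zero_const f"
    and "0 \<le> \<eta>" "\<And>i. ncps_summable \<eta> (f i)" "\<And>i. ncps_norm \<eta> (f i) \<le> \<rho>"
    and "\<And>i. ncps_summable \<rho> (g i)" and "\<And>i. norm (X $ i) \<le> \<eta>"
  shows "(\<chi> i. ncps_eval (g i) (\<chi> j. ncps_eval (f j) X)) = X"
proof -
  have "ncps_eval (g i) (\<chi> j. ncps_eval (f j) X) = X $ i" for i
    using ncps_eval_compose[of \<eta> f \<rho> "g i" X] assms by (simp add: ncps_eval_var zero_const_def)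
  then show ?thesis by (simp add: vec_eq_iff)
qed

text \<open>Membership constrains X and f(X) in the same way. Passing to Y = f(X), with X = g(Y),
  merely swaps the two conditions, so the image is described by the same formula for g and
  surjectivity needs no open mapping argument.\<close>

definition ncps_domain :: "real \<Rightarrow> ('n \<Rightarrow> 'n ncps) \<Rightarrow> ('a::chilbert_space bop^'n) set"
  where "ncps_domain \<eta> f = {X. \<forall>i. norm (X $ i) < \<eta> \<and> norm (ncps_eval (f i) X) < \<eta>}"

lemma open_ncps_domain:
  fixes f :: "'n::finite \<Rightarrow> 'n ncps"
  assumes "\<And>i. ncps_summable \<eta> (f i)"
  shows "open (ncps_domain \<eta> f :: ('a::chilbert_space bop^'n) set)"
proof -
  define B where "B = (\<Inter>i. {X :: 'a bop^'n. norm (X $ i) < \<eta>})"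
  have "open B"
    unfolding B_def by (intro open_INT ballI open_Collect_less continuous_intros) simp
  have "continuous_on B (\<lambda>X. norm (ncps_eval (f i) X))" for i
    by (intro continuous_on_norm continuous_on_subset[OF continuous_on_ncps_eval[OF assms]])
      (auto simp: B_def less_imp_le)
  then have "open (\<Inter>i. B \<inter> (\<lambda>X. norm (ncps_eval (f i) X)) -` {..<\<eta>})"
    using \<open>open B\<close> by (intro open_INT ballI continuous_open_preimage) auto
  also have "(\<Inter>i. B \<inter> (\<lambda>X. norm (ncps_eval (f i) X)) -` {..<\<eta>}) = ncps_domain \<eta> f"
    by (auto simp: B_def ncps_domain_def)
  finally show ?thesis .
qed

lemma op_ball_subset_ncps_domain:
  fixes f :: "'n::finite \<Rightarrow> 'n ncps"
  assumes "0 < \<eta>" "\<And>i. ncps_summable \<eta> (f i)" "zero_const f"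
  obtains r where "0 < r" "op_ball r \<subseteq> (ncps_domain \<eta> f :: ('a::chilbert_space bop^'n) set)"
proof -
  obtain r where r: "0 < r" "r \<le> \<eta>" "\<And>\<tau> i. 0 \<le> \<tau> \<Longrightarrow> \<tau> \<le> r \<Longrightarrow> ncps_norm \<tau> (f i) < \<eta>"
    by (rule ncps_norm_small[where f = f, OF assms(1,2,3,1)]) blast
  have "X \<in> ncps_domain \<eta> f" if "X \<in> op_ball r" for X :: "'a bop^'n"
  proof -
    have X: "norm (X $ i) \<le> r" for i
      using norm_component_less_of_op_ball[OF that] by (simp add: less_imp_le)
    have "ncps_summable r (f i)" for i
      using ncps_mono[OF assms(2)] r by simp
    from norm_ncps_eval_le[OF this X] have "norm (ncps_eval (f i) X) < \<eta>" for i
      by (rule order.strict_trans1) (use r in simp)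
    then show ?thesis
      using r(2) norm_component_less_of_op_ball[OF that]
      by (auto simp: ncps_domain_def intro: order.strict_trans2)
  qed
  with r(1) that show ?thesis by blast
qed

lemma hom_part_sums_on_ncps_domain:
  fixes f :: "'n::finite \<Rightarrow> 'n ncps"
  assumes "\<And>i. ncps_summable \<eta> (f i)" "X \<in> ncps_domain \<eta> f"
  shows "hom_part (f i) X sums (eval_tuple f X $ i)" "eval_tuple f X = (\<chi> i. ncps_eval (f i) X)"
proof -
  have *: "hom_part (f i) X sums ncps_eval (f i) X" for i
    using assms by (intro hom_part_sums_ncps_eval) (auto simp: ncps_domain_def less_imp_le)
  then show "eval_tuple f X = (\<chi> i. ncps_eval (f i) X)"
    by (simp add: eval_tuple_def vec_eq_iff sums_unique[symmetric])
  with * show "hom_part (f i) X sums (eval_tuple f X $ i)" by simp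
qed

text \<open>Evaluating the formal identity for g after f gives g(f(X)) = X, and the two norm
  conditions on X become those on f(X). With f and g interchanged it yields the other
  direction.\<close>

lemma eval_tuple_inverse_on_ncps_domain:
  fixes f g :: "'n::finite \<Rightarrow> 'n ncps"
  assumes "\<And>i. ncps_compose (g i) f = ncps_var i" "zero_const f" "0 < \<eta>" "\<eta> \<le> \<rho>"
    and "\<And>i. ncps_summable \<rho> (f i)" "\<And>i. ncps_summable \<rho> (g i)" "\<And>i. ncps_norm \<eta> (f i) < \<rho>"
    and X: "X \<in> ncps_domain \<eta> f"
  shows "eval_tuple f X \<in> ncps_domain \<eta> g" "eval_tuple g (eval_tuple f X) = X"
proof -
  have f: "ncps_summable \<eta> (f i)" and g: "ncps_summable \<eta> (g i)" for i
    using ncps_mono[OF assms(5)] ncps_mono[OF assms(6)] assms(3,4) by simp_all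
  have inv: "(\<chi> i. ncps_eval (g i) (eval_tuple f X)) = X"
    unfolding hom_part_sums_on_ncps_domain(2)[where f = f, OF f X]
    using assms f by (intro ncps_eval_inverse[of g f \<eta> \<rho>]) (auto simp: less_imp_le ncps_domain_def)
  then have "ncps_eval (g i) (eval_tuple f X) = X $ i" for i
    by (simp add: vec_eq_iff)
  then show *: "eval_tuple f X \<in> ncps_domain \<eta> g"
    using X by (simp add: hom_part_sums_on_ncps_domain(2)[where f = f, OF f X]) (simp add: ncps_domain_def)
  show "eval_tuple g (eval_tuple f X) = X"
    unfolding hom_part_sums_on_ncps_domain(2)[where f = g, OF g *] by (rule inv)
qed

theorem theorem1p4:
  fixes f g :: "'n::finite \<Rightarrow> 'n ncps"
  assumes "separable_space (euclidean :: 'h::chilbert_space topology)"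
    and "infinite_dimensional TYPE('h)"
    and "tuple_radius f \<noteq> 0"
    and "zero_const f"
    and "det (jacobian0 f) \<noteq> 0"
    and "comp_inverse f g"
    and "tuple_radius g \<noteq> 0"
  shows "\<exists>D G :: ('h bop^'n) set.
    open D \<and> 0 \<in> D \<and> open G \<and> 0 \<in> G \<and>
    converges_on f D \<and> bij_betw (eval_tuple f) D G \<and> free_holomorphic_map D (eval_tuple f) \<and>
    converges_on g G \<and> bij_betw (eval_tuple g) G D \<and>
    free_holomorphic_map G (the_inv_into D (eval_tuple f)) \<and>
    (\<forall>Y\<in>G. the_inv_into D (eval_tuple f) Y = eval_tuple g Y)"
proof -
  have zero: "zero_const f" "zero_const g"
    and comp: "\<And>i. ncps_compose (f i) g = ncps_var i" "\<And>i. ncps_compose (g i) f = ncps_var i"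
    using assms by (auto simp: comp_inverse_def)
  obtain \<rho>\<^sub>1 where \<rho>\<^sub>1: "0 < \<rho>\<^sub>1" "\<And>i. ncps_summable \<rho>\<^sub>1 (f i)"
    using ncps_summable_of_tuple_radius[OF assms(3)] by blast
  obtain \<rho>\<^sub>2 where \<rho>\<^sub>2: "0 < \<rho>\<^sub>2" "\<And>i. ncps_summable \<rho>\<^sub>2 (g i)"
    using ncps_summable_of_tuple_radius[OF assms(7)] by blast
  define \<rho> where "\<rho> = min \<rho>\<^sub>1 \<rho>\<^sub>2"
  have \<rho>: "0 < \<rho>" "\<And>i. ncps_summable \<rho> (f i)" "\<And>i. ncps_summable \<rho> (g i)"
    using ncps_mono[OF \<rho>\<^sub>1(2)] ncps_mono[OF \<rho>\<^sub>2(2)] \<rho>\<^sub>1(1) \<rho>\<^sub>2(1) by (simp_all add: \<rho>_def)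
  obtain \<sigma>\<^sub>1 where \<sigma>\<^sub>1: "0 < \<sigma>\<^sub>1" "\<And>\<tau> i. 0 \<le> \<tau> \<Longrightarrow> \<tau> \<le> \<sigma>\<^sub>1 \<Longrightarrow> ncps_norm \<tau> (f i) < \<rho>"
    by (rule ncps_norm_small[where f = f, OF \<rho>(1,2) zero(1) \<rho>(1)]) blast
  obtain \<sigma>\<^sub>2 where \<sigma>\<^sub>2: "0 < \<sigma>\<^sub>2" "\<And>\<tau> i. 0 \<le> \<tau> \<Longrightarrow> \<tau> \<le> \<sigma>\<^sub>2 \<Longrightarrow> ncps_norm \<tau> (g i) < \<rho>"
    by (rule ncps_norm_small[where f = g, OF \<rho>(1,3) zero(2) \<rho>(1)]) blast
  \<comment> \<open>A single \<open>\<eta>\<close> for both sides keeps D and G symmetric; it is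
    small enough that f and g both have norm below \<open>\<rho>\<close>, where the outer series is
    summable.\<close>
  define \<eta> where "\<eta> = min \<rho> (min \<sigma>\<^sub>1 \<sigma>\<^sub>2)"
  have \<eta>: "0 < \<eta>" "\<eta> \<le> \<rho>" "\<And>i. ncps_norm \<eta> (f i) < \<rho>" "\<And>i. ncps_norm \<eta> (g i) < \<rho>"
    using \<rho>(1) \<sigma>\<^sub>1 \<sigma>\<^sub>2 by (simp_all add: \<eta>_def)
  have f: "ncps_summable \<eta> (f i)" and g: "ncps_summable \<eta> (g i)" for i
    using ncps_mono[OF \<rho>(2)] ncps_mono[OF \<rho>(3)] \<eta> by simp_all
  define D G :: "('h bop^'n) set" where "D = ncps_domain \<eta> f" and "G = ncps_domain \<eta> g"
  have fX: "eval_tuple f X \<in> G" "eval_tuple g (eval_tuple f X) = X" if "X \<in> D" for X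
    using eval_tuple_inverse_on_ncps_domain[where f = f and g = g, OF comp(2) zero(1) \<eta>(1,2) \<rho>(2,3) \<eta>(3)] that
    unfolding D_def G_def by blast+
  have gY: "eval_tuple g Y \<in> D" "eval_tuple f (eval_tuple g Y) = Y" if "Y \<in> G" for Y
    using eval_tuple_inverse_on_ncps_domain[where f = g and g = f, OF comp(1) zero(2) \<eta>(1,2) \<rho>(3,2) \<eta>(4)] that
    unfolding D_def G_def by blast+
  have bij: "bij_betw (eval_tuple f) D G" "bij_betw (eval_tuple g) G D"
    by (rule bij_betwI[where g = "eval_tuple g"] bij_betwI[where g = "eval_tuple f"]; use fX gY in auto)+
  have inv: "the_inv_into D (eval_tuple f) Y = eval_tuple g Y" if "Y \<in> G" for Y
    using the_inv_into_f_f[OF bij_betw_imp_inj_on[OF bij(1)] gY(1)[OF that]] gY(2)[OF that] by simp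
  have sums: "hom_part (f i) X sums (eval_tuple f X $ i)" if "X \<in> D" for X i
    using hom_part_sums_on_ncps_domain(1)[where f = f, OF f] that by (simp add: D_def)
  have sums': "hom_part (g i) Y sums (eval_tuple g Y $ i)" if "Y \<in> G" for Y i
    using hom_part_sums_on_ncps_domain(1)[where f = g, OF g] that by (simp add: G_def)
  have ball: "\<exists>r>0. op_ball r \<subseteq> D" "\<exists>r>0. op_ball r \<subseteq> G"
    unfolding D_def G_def
    by (rule op_ball_subset_ncps_domain[where f = f, OF \<eta>(1) f zero(1)], blast)
      (rule op_ball_subset_ncps_domain[where f = g, OF \<eta>(1) g zero(2)], blast)
  have "open D" "open G"
    unfolding D_def G_def using f g by (simp_all add: open_ncps_domain)
  moreover have "0 \<in> D" "0 \<in> G"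
    using ball zero_in_op_ball by blast+
  moreover have "converges_on f D" "converges_on g G"
    using sums sums' by (auto simp: converges_on_def sums_iff)
  moreover have "free_holomorphic_map D (eval_tuple f)"
    unfolding free_holomorphic_map_def free_holomorphic_def using ball(1) sums by blast
  moreover have "free_holomorphic_map G (the_inv_into D (eval_tuple f))"
    unfolding free_holomorphic_map_def free_holomorphic_def using ball(2) sums' inv by metis
  ultimately show ?thesis
    using bij inv by blast
qed

end
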